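(* Let $\lambda$ be a nonzero real number. For all integers $n\ge k\ge 0$, $$H_{\lambda}(n,k)=\frac{1}{k!}\sum_{j=0}^{k}\binom{k}{j}(-1)^{k-j}\langle j\rangle_{n,\lambda}.$$
   Context: For $\lambda\in\mathbb{R}$, $\lambda\neq 0$: $\langle x\rangle_{0,\lambda}=1$, $\langle x\rangle_{n,\lambda}=x(x+\lambda)\cdots(x+(n-1)\lambda)$ for $n\ge 1$. The falling factorial is $(x)_0=1$, $(x)_n=x(x-1)\cdots(x-n+1)$ for $n\ge 1$. The heterogeneous Stirling numbers of the second kind $H_\lambda(n,k)$ are defined by the polynomial identity $\langle x\rangle_{n,\lambda}=\sum_{k=0}^{n}H_{\lambda}(n,k)(x)_{k}$ for $n\ge 0$, with $H_\lambda(n,k)=0$ for $k<0$ or $n<k$. *)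

theory Defs
  imports Complex_Main "HOL-Computational_Algebra.Polynomial"
begin

text \<open>
  As real polynomials in x, where \<open>[:a, 1:]\<close> is \<open>x + a\<close>:
  \<open>gen_rising lam n = x (x + lam) \<dots> (x + (n - 1) lam)\<close> and \<open>falling n = x (x - 1) \<dots> (x - n + 1)\<close>.
\<close>

definition gen_rising :: "real \<Rightarrow> nat \<Rightarrow> real poly" where
  "gen_rising lam n = (\<Prod>i<n. [:real i * lam, 1:])"

definition falling :: "nat \<Rightarrow> real poly" where
  "falling n = (\<Prod>i<n. [:- real i, 1:])"

definition is_het_stirling2 :: "real \<Rightarrow> (nat \<Rightarrow> nat \<Rightarrow> real) \<Rightarrow> bool" where
  "is_het_stirling2 lam h \<longleftrightarrow>
     (\<forall>n. gen_rising lam n = (\<Sum>k=0..n. smult (h n k) (falling k))) \<and>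
     (\<forall>n k. n < k \<longrightarrow> h n k = 0)"

definition het_stirling2 :: "real \<Rightarrow> nat \<Rightarrow> nat \<Rightarrow> real" where
  "het_stirling2 lam = (THE h. is_het_stirling2 lam h)"

text \<open>The description above is proper: such a family exists and is unique.\<close>

lemma falling_degree: "degree (falling n) = n"
  unfolding falling_def by (subst degree_prod_eq_sum_degree) auto

lemma falling_lead: "coeff (falling n) n = 1"
proof -
  have "lead_coeff (falling n) = 1"
    unfolding falling_def lead_coeff_prod by simp
  then show ?thesis by (simp add: falling_degree)
qed

lemma falling_independent:
  assumes "(\<Sum>k=0..n. smult (c k) (falling k)) = 0" and "k \<le> n"
  shows "c k = 0"
  using assms
proof (induction n arbitrary: k)
  case 0
  then show ?case by (simp add: falling_def)
next
  case (Suc n)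
  have "coeff (\<Sum>k=0..Suc n. smult (c k) (falling k)) (Suc n) = c (Suc n)"
    by (simp add: coeff_sum falling_lead coeff_eq_0 falling_degree)
  then have c: "c (Suc n) = 0" unfolding Suc.prems(1) by simp
  show ?case
  proof (cases "k = Suc n")
    case False
    then show ?thesis using Suc c by simp
  qed (simp add: c)
qed

lemma gen_rising_expansion:
  "\<exists>c. gen_rising lam n = (\<Sum>k=0..n. smult (c k) (falling k))"
proof (induction n)
  case 0
  show ?case by (rule exI[of _ "\<lambda>_. 1"]) (simp add: gen_rising_def falling_def)
next
  case (Suc n)
  then obtain c where c: "gen_rising lam n = (\<Sum>k=0..n. smult (c k) (falling k))" by blast
  define a where "a k = (if k \<le> n then (real k + real n * lam) * c k else 0)" for k
  define b where "b k = (if k = 0 then 0 else c (k - 1))" for k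
  have step: "[:real n * lam, 1:] * falling k
      = falling (Suc k) + smult (real k + real n * lam) (falling k)" for k
    by (simp add: falling_def algebra_simps smult_add_left)
  have "gen_rising lam (Suc n) = [:real n * lam, 1:] * gen_rising lam n"
    by (simp add: gen_rising_def mult.commute)
  also have "\<dots> = (\<Sum>k=0..n. smult (c k) ([:real n * lam, 1:] * falling k))"
    unfolding c sum_distrib_left by (simp only: mult_smult_right)
  also have "\<dots> = (\<Sum>k=0..n. smult (c k) (falling (Suc k))) + (\<Sum>k=0..n. smult (a k) (falling k))"
    unfolding step by (simp add: a_def smult_add_right sum.distrib mult.commute)
  also have "(\<Sum>k=0..n. smult (c k) (falling (Suc k))) = (\<Sum>k=0..Suc n. smult (b k) (falling k))"
    by (subst sum.atLeast0_atMost_Suc_shift) (simp add: b_def)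
  also have "(\<Sum>k=0..n. smult (a k) (falling k)) = (\<Sum>k=0..Suc n. smult (a k) (falling k))"
    by (simp add: a_def)
  finally have "gen_rising lam (Suc n) = (\<Sum>k=0..Suc n. smult (b k + a k) (falling k))"
    by (simp only: smult_add_left sum.distrib)
  then show ?case by (rule exI[of _ "\<lambda>k. b k + a k"])
qed

lemma ex1_het_stirling2: "\<exists>!h. is_het_stirling2 lam h"
proof (rule ex_ex1I)
  obtain c where c: "\<And>n. gen_rising lam n = (\<Sum>k=0..n. smult (c n k) (falling k))"
    using gen_rising_expansion by metis
  have "is_het_stirling2 lam (\<lambda>n k. if k \<le> n then c n k else 0)"
    unfolding is_het_stirling2_def by (auto simp: c intro!: sum.cong)
  then show "\<exists>h. is_het_stirling2 lam h" by blast
next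
  fix g h
  assume g: "is_het_stirling2 lam g" and h: "is_het_stirling2 lam h"
  show "g = h"
  proof (intro ext)
    fix n k
    show "g n k = h n k"
    proof (cases "k \<le> n")
      case True
      have "(\<Sum>k=0..n. smult (g n k - h n k) (falling k)) = 0"
        using g h unfolding is_het_stirling2_def
        by (simp add: smult_diff_left sum_subtractf flip: atLeast0AtMost)
      from falling_independent[OF this True] show ?thesis by simp
    qed (use g h in \<open>auto simp: is_het_stirling2_def\<close>)
  qed
qed

lemma het_stirling2: "is_het_stirling2 lam (het_stirling2 lam)"
  unfolding het_stirling2_def by (rule theI'[OF ex1_het_stirling2])

end

theory Submission
  imports Defs
begin

text \<open>The formula is binomial inversion. By \<open>poly_falling_of_nat\<close>, evaluating the
  defining expansion at x = j gives the sum over m of \<open>?h m * fact m\<close> times the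
  binomial coefficient of j over m. The alternating sum over j is the k-th forward difference at 0;
  by \<open>binomial_orthogonality\<close> it isolates the coefficient with m = k, and division by
  k! leaves the Stirling number.\<close>

lemma poly_falling_of_nat: "poly (falling m) (real j) = fact m * real (j choose m)"
  by (simp add: falling_def poly_prod binomial_gbinomial gbinomial_prod_rev atLeast0LessThan)

text \<open>Trinomial revision pulls out a factor free of j and leaves the expansion of (1 - 1)^(k -
  m), which vanishes unless m = k. For m > k every term is zero.\<close>

lemma binomial_orthogonality:
  "(\<Sum>j=0..k. real (k choose j) * (-1) ^ (k - j) * real (j choose m)) = (if m = k then 1 else 0)"
proof (cases "m \<le> k")
  case True
  have "(\<Sum>j=0..k. real (k choose j) * (-1) ^ (k - j) * real (j choose m))
      = (\<Sum>j=m..k. real (k choose j) * (-1) ^ (k - j) * real (j choose m))"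
    by (rule sum.mono_neutral_right) auto
  also have "\<dots> = (\<Sum>j=m..k. real (k choose m) * (real (k - m choose (j - m)) * (-1) ^ (k - j)))"
  proof (rule sum.cong)
    fix j assume "j \<in> {m..k}"
    then have "(k choose j) * (j choose m) = (k choose m) * (k - m choose (j - m))"
      by (intro choose_mult) auto
    then have "real (k choose j) * real (j choose m) = real (k choose m) * real (k - m choose (j - m))"
      by (metis of_nat_mult)
    then show "real (k choose j) * (-1) ^ (k - j) * real (j choose m)
        = real (k choose m) * (real (k - m choose (j - m)) * (-1) ^ (k - j))"
      by (simp add: mult_ac)
  qed simp
  \<comment> \<open>Shift by i = j - m; the factor \<open>1 ^ i\<close> gives the sum the shape of
    the binomial theorem.\<close>
  also have "\<dots> = real (k choose m) * (\<Sum>i\<le>k - m. real (k - m choose i) * 1 ^ i * (-1) ^ (k - m - i))"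
    unfolding sum_distrib_left
    by (rule sum.reindex_bij_witness[of _ "\<lambda>i. i + m" "\<lambda>j. j - m"]) (use True in auto)
  also have "\<dots> = real (k choose m) * (1 + (-1)) ^ (k - m)"
    by (simp only: binomial_ring)
  finally show ?thesis
    using True by (simp add: power_0_left)
qed (auto intro!: sum.neutral)

theorem theorem2p2:
  fixes lam :: real and n k :: nat
  assumes "lam \<noteq> 0" and "k \<le> n"
  shows "het_stirling2 lam n k =
    1 / fact k * (\<Sum>j=0..k. real (k choose j) * (-1) ^ (k - j) * poly (gen_rising lam n) (real j))"
proof -
  let ?h = "het_stirling2 lam n"
  have "gen_rising lam n = (\<Sum>m=0..n. smult (?h m) (falling m))"
    using het_stirling2 unfolding is_het_stirling2_def by blast
  then have eval: "poly (gen_rising lam n) (real j) = (\<Sum>m=0..n. ?h m * fact m * real (j choose m))" for j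
    by (simp add: poly_sum poly_falling_of_nat mult.assoc)
  have "(\<Sum>j=0..k. real (k choose j) * (-1) ^ (k - j) * poly (gen_rising lam n) (real j))
      = (\<Sum>m=0..n. \<Sum>j=0..k. ?h m * fact m * (real (k choose j) * (-1) ^ (k - j) * real (j choose m)))"
    unfolding eval sum_distrib_left by (subst sum.swap) (simp add: mult_ac)
  also have "\<dots> = (\<Sum>m=0..n. ?h m * fact m * (if m = k then 1 else 0))"
    by (simp only: binomial_orthogonality flip: sum_distrib_left)
  \<comment> \<open>Since \<open>k \<le> n\<close>, the index k lies in the range of summation, so
    exactly one term survives.\<close>
  also have "\<dots> = ?h k * fact k"
    using assms(2) by (simp add: if_distrib cong: if_cong)
  finally show ?thesis by simp
qed

end
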